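(* Let $p$ be a fixed prime and, for a nonzero integer $a$, let $v(a)$ denote the exponent of $p$ in the prime factorization of $a$ (with $v(0)=+\infty$). Let $f,g\in\mathbb{Z}[x]$ be monic polynomials with nonzero resultant $r$. Let $s\ge 0$ be an integer and assume that $p^s$ divides both $f(n)$ and $g(n)$ for all $n\in\mathbb{Z}$. Let $$S=\max_{n\in\mathbb{Z}} v(\gcd(f(n),g(n))).$$ Then $v(r)-S\ge B(s+t)-2B(t)-s$ for all nonnegative integers $t$.
   Context: Define $\alpha(j)=v(j!)=\sum_{i\ge1}\lfloor j/p^i\rfloor$ for integers $j\ge 0$, $\beta(m)=\min\{j\ge 0:\alpha(j)\ge m\}$ for integers $m\ge 0$, and $B(s)=\sum_{m=1}^s\beta(m)$ (so $B(0)=0$). The resultant of $f$ and $g$ is the determinant of their Sylvester matrix (equivalently $\prod_{i,j}(\gamma_i-\delta_j)$ over the roots $\gamma_i$ of $f$ and $\delta_j$ of $g$). *)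

theory Defs
  imports "Subresultants.Resultant_Prelim" "HOL-Computational_Algebra.Primes"
begin

(* The p-adic valuation of a nonzero a is multiplicity p a. The library convention
   multiplicity p 0 = 0 is never used: factorials are nonzero, and two monic polynomials with
   nonzero resultant have no common root, so gcd (f(n)) (g(n)) is nonzero for all n. *)

definition alpha :: "nat \<Rightarrow> nat \<Rightarrow> nat" where
  "alpha p j = multiplicity p (fact j :: nat)"

(* For p prime, alpha p is unbounded, so the minimum exists. *)
definition beta :: "nat \<Rightarrow> nat \<Rightarrow> nat" where
  "beta p m = (LEAST j. m \<le> alpha p j)"

definition B :: "nat \<Rightarrow> nat \<Rightarrow> nat" where
  "B p s = (\<Sum>m = 1..s. beta p m)"

(* The valuations are bounded over n, since gcd (f(n)) (g(n)) divides the resultant;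
   hence, when the resultant is nonzero, this is the maximum of a finite nonempty set. *)
definition max_gcd_val :: "nat \<Rightarrow> int poly \<Rightarrow> int poly \<Rightarrow> nat" where
  "max_gcd_val p f g = (MAX n::int. multiplicity (int p) (gcd (poly f n) (poly g n)))"

end

theory Submission
  imports Defs
begin

text \<open>Let \<open>a\<close> be a point where \<open>v (gcd (f a) (g a)) = S\<close>, and let \<open>x\<^bsub>j\<^esub> = (x - a) \<cdots> (x - a - j + 1)\<close>.
  The values of \<open>p ^ (t - \<alpha> j) x\<^bsub>j\<^esub>\<close> (truncated subtraction) are divisible by \<open>p ^ t\<close>, so multiplying
  it by \<open>f\<close> or \<open>g\<close> gives a polynomial whose values are divisible by \<open>p ^ (s + t)\<close>, and by \<open>p ^ (S + t)\<close>
  at \<open>a\<close>. By Newton interpolation its coefficient at \<open>x\<^bsub>j\<^esub>\<close> is divisible by \<open>p ^ (s + t - \<alpha> j)\<close>, and by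
  \<open>p ^ (S + t)\<close> for \<open>j = 0\<close>. Unitriangular changes of basis turn the Sylvester matrix into the matrix
  of the polynomials \<open>x\<^bsub>i\<^esub> f\<close>, \<open>x\<^bsub>i\<^esub> g\<close> in the basis \<open>x\<^bsub>j\<^esub>\<close>; comparing determinants bounds \<open>v r\<close> below by
  \<open>S - s + (\<Sum>j<N. s + t - \<alpha> j)\<close> minus two partial sums of \<open>\<Sum>j. t - \<alpha> j\<close>. The full sum
  \<open>\<Sum>j. m - \<alpha> j\<close> is \<open>B m\<close>. To make the first sum full, \<open>g\<close> is given a larger formal degree, which does
  not change the determinant because \<open>f\<close> is monic.\<close>

section \<open>Falling factorial polynomials and Newton expansion\<close>

definition ffact_poly :: "int \<Rightarrow> nat \<Rightarrow> int poly" where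
  "ffact_poly a j = (\<Prod>k<j. [:- (a + int k), 1:])"

lemma monic_ffact_poly: "monic (ffact_poly a j)"
  unfolding ffact_poly_def by (rule monic_prod) auto

lemma degree_ffact_poly [simp]: "degree (ffact_poly a j) = j"
  unfolding ffact_poly_def by (subst degree_prod_sum_eq) auto

lemma poly_ffact_poly: "poly (ffact_poly a j) (a + int k) = fact j * int (k choose j)"
proof (induction j)
  case 0
  then show ?case by (simp add: ffact_poly_def)
next
  case (Suc j)
  \<comment> \<open>The new linear factor takes the value \<open>int k - int j\<close>, which may be
    negative; in that case both binomials vanish.\<close>
  have *: "int (k choose j) * (int k - int j) = int (Suc j) * int (k choose Suc j)"
  proof (cases "j \<le> k")
    case True
    have "Suc j * (k choose Suc j) = (k - j) * (k choose j)"
      using binomial_absorb_comp[of k j] binomial_absorption[of j k]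
      by (simp add: binomial_absorption)
    then show ?thesis
      using True by (simp only: of_nat_diff[symmetric] of_nat_mult[symmetric] mult.commute)
  qed (simp add: binomial_eq_0)
  have "poly (ffact_poly a (Suc j)) (a + int k)
      = fact j * (int (k choose j) * (int k - int j))"
    using Suc by (simp add: ffact_poly_def algebra_simps)
  also have "\<dots> = fact (Suc j) * int (k choose Suc j)"
    unfolding * by (simp add: algebra_simps)
  finally show ?case .
qed

lemma newton_expansion_exists:
  assumes "\<And>i. N \<le> i \<Longrightarrow> coeff h i = 0"
  shows "\<exists>c. h = (\<Sum>j<N. smult (c j) (ffact_poly a j))"
  using assms
proof (induction N arbitrary: h)
  case 0
  then show ?case by (auto simp: poly_eq_iff)
next
  case (Suc N)
  let ?h = "h - smult (coeff h N) (ffact_poly a N)"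
  have "coeff ?h i = 0" if "N \<le> i" for i
  proof (cases "i = N")
    case True
    then show ?thesis using monic_ffact_poly[of a N] by simp
  next
    case False
    then have "coeff (ffact_poly a N) i = 0" "coeff h i = 0"
      using that Suc.prems[of i] by (auto intro: coeff_eq_0)
    then show ?thesis by simp
  qed
  from Suc.IH[OF this] obtain c where c: "?h = (\<Sum>j<N. smult (c j) (ffact_poly a j))" ..
  then have "h = (\<Sum>j<Suc N. smult ((c(N := coeff h N)) j) (ffact_poly a j))"
    by (simp add: algebra_simps)
  then show ?case by blast
qed

text \<open>At the node \<open>a + int k\<close> all terms with index above \<open>k\<close> vanish
  and term \<open>k\<close> equals \<open>c k * fact k\<close>, so the values determine these
  products through a triangular system with integer coefficients.\<close>

lemma newton_coeff_dvd:
  assumes h: "h = (\<Sum>j<N. smult (c j) (ffact_poly a j))"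
    and d: "\<And>k. d dvd poly h (a + int k)"
    and "j < N"
  shows "d dvd c j * fact j"
  using \<open>j < N\<close>
proof (induction j rule: less_induct)
  case (less k)
  let ?T = "\<lambda>j. c j * fact j * int (k choose j)"
  have "poly h (a + int k) = (\<Sum>j<N. ?T j)"
    unfolding h poly_sum by (simp add: poly_ffact_poly mult.assoc)
  also have "\<dots> = (\<Sum>j\<in>{..<Suc k}. ?T j)"
    using less.prems by (intro sum.mono_neutral_right) (auto simp: not_less_eq)
  also have "\<dots> = (\<Sum>j<k. ?T j) + c k * fact k"
    by simp
  finally have eq: "c k * fact k = poly h (a + int k) - (\<Sum>j<k. ?T j)"
    by simp
  have "d dvd (\<Sum>j<k. ?T j)"
    using less.prems by (intro dvd_sum dvd_mult2[OF less.IH]) auto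
  then show ?case
    unfolding eq using d by (intro dvd_diff) auto
qed

lemma newton_coeff_0:
  assumes "h = (\<Sum>j<N. smult (c j) (ffact_poly a j))" "0 < N"
  shows "c 0 = poly h a"
proof -
  have "poly (ffact_poly a j) a = (if j = 0 then 1 else 0)" for j
    using poly_ffact_poly[of a j 0] by auto
  then have "poly h a = (\<Sum>j<N. if j = 0 then c j else 0)"
    unfolding assms(1) poly_sum by (intro sum.cong) auto
  then show ?thesis using \<open>0 < N\<close> by simp
qed

section \<open>Determinants: column divisors, row scaling, unitriangular matrices\<close>

text \<open>Each term of the Leibniz formula takes exactly one entry from every column.\<close>

lemma det_col_dvd:
  fixes A :: "'a :: comm_ring_1 mat"
  assumes A: "A \<in> carrier_mat n n"
    and d: "\<And>i j. i < n \<Longrightarrow> j < n \<Longrightarrow> d j dvd A $$ (i, j)"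
  shows "(\<Prod>j<n. d j) dvd det A"
  unfolding det_def'[OF A]
proof (intro dvd_sum dvd_mult)
  fix \<sigma> assume "\<sigma> \<in> {\<sigma>. \<sigma> permutes {0..<n}}"
  then have \<sigma>: "\<sigma> permutes {0..<n}" by simp
  have "(\<Prod>j<n. d j) = (\<Prod>i = 0..<n. d (\<sigma> i))"
    using prod.permute[OF \<sigma>, of d] by (simp add: atLeast0LessThan comp_def)
  also have "\<dots> dvd (\<Prod>i = 0..<n. A $$ (i, \<sigma> i))"
    using permutes_in_image[OF \<sigma>] by (intro prod_dvd_prod d) auto
  finally show "(\<Prod>j<n. d j) dvd (\<Prod>i = 0..<n. A $$ (i, \<sigma> i))" .
qed

lemma det_scale_rows:
  fixes A :: "'a :: comm_ring_1 mat"
  assumes A: "A \<in> carrier_mat n n"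
  shows "det (mat n n (\<lambda>(i, j). d i * A $$ (i, j))) = (\<Prod>i<n. d i) * det A"
proof -
  have "det (mat n n (\<lambda>(i, j). d i * A $$ (i, j)))
      = (\<Sum>\<sigma> | \<sigma> permutes {0..<n}. signof \<sigma> * (\<Prod>i = 0..<n. d i * A $$ (i, \<sigma> i)))"
    by (subst det_def'[of _ n]) (auto intro!: sum.cong prod.cong simp: permutes_in_image)
  then show ?thesis
    unfolding det_def'[OF A] by (simp add: prod.distrib sum_distrib_left mult_ac atLeast0LessThan)
qed

lemma det_unitriangular:
  fixes F :: "nat \<Rightarrow> nat \<Rightarrow> 'a :: comm_ring_1"
  assumes "\<And>i j. j < i \<Longrightarrow> i < n \<Longrightarrow> F i j = 0" "\<And>i. i < n \<Longrightarrow> F i i = 1"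
  shows "det (mat n n (\<lambda>(i, j). F i j)) = 1"
proof -
  let ?A = "mat n n (\<lambda>(i, j). F i j)"
  have "diag_mat ?A = replicate n 1"
    using assms(2) by (intro nth_equalityI) (auto simp: diag_mat_def)
  moreover have "det ?A = prod_list (diag_mat ?A)"
    using assms(1) by (intro det_upper_triangular[of _ n]) auto
  ultimately show ?thesis by (simp add: prod_list_replicate)
qed

section \<open>Resultants with padded formal degree and in other bases\<close>

text \<open>Since \<open>coeff q (Suc n) = 0\<close>, the first column of the larger Sylvester
  matrix has only its top entry; expand along it.\<close>

lemma resultant_sub_Suc:
  assumes "degree q \<le> n"
  shows "resultant_sub m (Suc n) p q = coeff p m * resultant_sub m n p q"
proof -
  let ?S = "sylvester_mat_sub m (Suc n) p q"
  have S: "?S \<in> carrier_mat (Suc (m + n)) (Suc (m + n))"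
    using sylvester_mat_sub_carrier[of m "Suc n" p q] by simp
  have z: "?S $$ (i, 0) = (if i = 0 then coeff p m else 0)" if "i < Suc (m + n)" for i
    using that assms by (subst sylvester_mat_sub_index) (auto simp: coeff_eq_0)
  \<comment> \<open>In the minor the band of \<open>q\<close> is one diagonal wider than in the
    smaller Sylvester matrix; on that diagonal \<open>i - j = Suc n\<close> exceeds the degree of
    \<open>q\<close>.\<close>
  have q0: "coeff q (i - j) = 0" if "i - n \<le> Suc j" "\<not> i - n \<le> j" for i j
    using that assms by (intro coeff_eq_0) auto
  have minor: "mat_delete ?S 0 0 = sylvester_mat_sub m n p q"
    by (rule eq_matI) (auto simp: mat_delete_def sylvester_mat_sub_def q0)
  have "det ?S = (\<Sum>i<Suc (m + n). ?S $$ (i, 0) * cofactor ?S i 0)"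
    using laplace_expansion_column[OF S, of 0] by simp
  also have "\<dots> = (\<Sum>i<Suc (m + n). if i = 0 then coeff p m * cofactor ?S i 0 else 0)"
    by (intro sum.cong) (auto simp: z)
  also have "\<dots> = coeff p m * cofactor ?S 0 0"
    by simp
  finally show ?thesis
    by (simp add: resultant_sub_def cofactor_def minor)
qed

lemma resultant_sub_monic:
  assumes "monic p"
  shows "resultant_sub (degree p) (degree q + k) p q = resultant p q"
  by (induction k) (auto simp: resultant_sub resultant_sub_Suc assms)

lemma coeff_mult_sum_monom:
  fixes u p :: "'a :: comm_semiring_1 poly"
  assumes "degree u < n"
  shows "coeff (u * p) i = (\<Sum>l<n. coeff u l * coeff (monom 1 l * p) i)"
proof -
  have "u = (\<Sum>l<n. monom (coeff u l) l)"
    using assms by (auto simp: poly_eq_iff coeff_sum intro!: coeff_eq_0)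
  then have "u * p = (\<Sum>l<n. smult (coeff u l) (monom 1 l * p))"
    by (metis (no_types, lifting) mult.right_neutral mult_smult_left smult_monom sum.cong sum_distrib_right)
  then show ?thesis by (simp add: coeff_sum)
qed

text \<open>If \<open>u k\<close> is the monomial of degree \<open>k\<close>, these are the rows of the Sylvester matrix read as
  polynomials. Both there and here columns are ordered by decreasing degree.\<close>

definition row_poly ::
  "nat \<Rightarrow> nat \<Rightarrow> (nat \<Rightarrow> 'a poly) \<Rightarrow> 'a poly \<Rightarrow> 'a poly \<Rightarrow> nat \<Rightarrow> 'a :: comm_ring_1 poly" where
  "row_poly m n u f g i = (if i < n then u (n - 1 - i) * f else u (m + n - 1 - i) * g)"

text \<open>Expanding each \<open>u k\<close> in monomials writes the matrix as \<open>T\<close>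
  times the Sylvester matrix. \<open>T\<close> is block diagonal with unitriangular blocks, one for
  the multiples of \<open>f\<close> and one for those of \<open>g\<close>.\<close>

lemma det_row_poly:
  fixes u :: "nat \<Rightarrow> 'a :: comm_ring_1 poly"
  assumes u: "\<And>k. degree (u k) = k" "\<And>k. monic (u k)"
    and deg: "degree f \<le> m" "degree g \<le> n"
  shows "det (mat (m + n) (m + n) (\<lambda>(i, j). coeff (row_poly m n u f g i) (m + n - 1 - j)))
       = resultant_sub m n f g"
proof -
  let ?N = "m + n"
  define F where "F i l = (if i < n then if l < n then coeff (u (n - 1 - i)) (n - 1 - l) else 0
      else coeff (u (?N - 1 - i)) (?N - 1 - l))" for i l
  define T where "T = mat ?N ?N (\<lambda>(i, l). F i l)"
  let ?S = "sylvester_mat_sub m n f g"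
  have u1: "coeff (u k) k = 1" for k
    using u[of k] by simp
  have detT: "det T = 1"
    unfolding T_def
  proof (rule det_unitriangular)
    show "F i l = 0" if "l < i" "i < ?N" for i l
      using that u(1) by (auto simp: F_def intro!: coeff_eq_0)
    show "F i i = 1" if "i < ?N" for i
      using u1 by (simp add: F_def)
  qed
  have Sf: "?S $$ (l, j) = coeff (monom 1 (n - 1 - l) * f) (?N - 1 - j)"
    if "l < n" "j < ?N" for l j
    using that deg by (auto simp: sylvester_mat_sub_index coeff_monom_mult intro!: coeff_eq_0 arg_cong[where f = "coeff f"])
  have Sg: "?S $$ (l, j) = coeff (monom 1 (?N - 1 - l) * g) (?N - 1 - j)"
    if "\<not> l < n" "l < ?N" "j < ?N" for l j
    using that deg by (auto simp: sylvester_mat_sub_index coeff_monom_mult intro!: coeff_eq_0 arg_cong[where f = "coeff g"])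
  have "T * ?S = mat ?N ?N (\<lambda>(i, j). coeff (row_poly m n u f g i) (?N - 1 - j))" (is "_ = ?R")
  proof (rule eq_matI)
    fix i j assume "i < dim_row ?R" "j < dim_col ?R"
    then have i: "i < ?N" and j: "j < ?N" by auto
    have "(T * ?S) $$ (i, j) = (\<Sum>l<?N. F i l * ?S $$ (l, j))"
      using i j by (simp add: T_def scalar_prod_def atLeast0LessThan)
    also have "\<dots> = coeff (row_poly m n u f g i) (?N - 1 - j)"
    proof (cases "i < n")
      case True
      have "(\<Sum>l<?N. F i l * ?S $$ (l, j)) = (\<Sum>l<n. F i l * ?S $$ (l, j))"
        using True by (intro sum.mono_neutral_right) (auto simp: F_def)
      also have "\<dots> = (\<Sum>l<n. coeff (u (n - 1 - i)) (n - 1 - l)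
          * coeff (monom 1 (n - 1 - l) * f) (?N - 1 - j))"
        using True j by (intro sum.cong) (auto simp: F_def Sf)
      also have "\<dots> = (\<Sum>l<n. coeff (u (n - 1 - i)) l * coeff (monom 1 l * f) (?N - 1 - j))"
        by (subst sum.nat_diff_reindex[symmetric]) simp
      also have "\<dots> = coeff (u (n - 1 - i) * f) (?N - 1 - j)"
        using True u(1) by (intro coeff_mult_sum_monom[symmetric]) simp
      finally show ?thesis using True by (simp add: row_poly_def)
    next
      case False
      have F0: "F i l = 0" if "l < n" for l
        using that False u(1) i by (auto simp: F_def intro!: coeff_eq_0)
      have "(\<Sum>l<?N. F i l * ?S $$ (l, j)) = (\<Sum>l<?N. coeff (u (?N - 1 - i)) (?N - 1 - l)
          * coeff (monom 1 (?N - 1 - l) * g) (?N - 1 - j))"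
      proof (intro sum.cong refl)
        fix l assume "l \<in> {..<?N}"
        then show "F i l * ?S $$ (l, j) = coeff (u (?N - 1 - i)) (?N - 1 - l)
          * coeff (monom 1 (?N - 1 - l) * g) (?N - 1 - j)"
          using F0[of l] False j by (cases "l < n") (auto simp: F_def Sg)
      qed
      also have "\<dots> = (\<Sum>l<?N. coeff (u (?N - 1 - i)) l * coeff (monom 1 l * g) (?N - 1 - j))"
        by (subst sum.nat_diff_reindex[symmetric]) simp
      also have "\<dots> = coeff (u (?N - 1 - i) * g) (?N - 1 - j)"
        using i u(1) by (intro coeff_mult_sum_monom[symmetric]) simp
      finally show ?thesis using False by (simp add: row_poly_def)
    qed
    finally show "(T * ?S) $$ (i, j) = ?R $$ (i, j)" using i j by simp
  qed (auto simp: T_def)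
  moreover have "det (T * ?S) = det T * det ?S"
    by (rule det_mult) (auto simp: T_def)
  ultimately show ?thesis
    using detT by (simp add: resultant_sub_def)
qed

section \<open>Prime powers in factorials\<close>

lemma multiplicity_fact_int: "multiplicity (int p) (fact j) = alpha p j"
proof -
  have "int p ^ n dvd fact j \<longleftrightarrow> p ^ n dvd fact j" for n
    by (metis of_nat_dvd_iff of_nat_fact of_nat_power)
  then show ?thesis by (simp add: alpha_def multiplicity_def)
qed

lemma power_dvd_power_mult_fact: "int p ^ t dvd int p ^ (t - alpha p j) * fact j"
proof -
  have "int p ^ t dvd int p ^ (t - alpha p j) * int p ^ alpha p j"
    unfolding power_add[symmetric] by (rule le_imp_power_dvd) simp
  also have "\<dots> dvd int p ^ (t - alpha p j) * fact j"
    by (intro mult_dvd_mono dvd_refl) (metis multiplicity_dvd multiplicity_fact_int)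
  finally show ?thesis .
qed

text \<open>Cancelling \<open>fact j\<close> costs only its own valuation \<open>alpha p j\<close>;
  this turns the divisibility from \<open>newton_coeff_dvd\<close> into one for the Newton
  coefficient itself.\<close>

lemma power_dvd_mult_fact_cancel:
  assumes p: "prime p" and d: "int p ^ M dvd c * fact j"
  shows "int p ^ (M - alpha p j) dvd c"
proof (cases "c = 0")
  case False
  have "M \<le> multiplicity (int p) (c * fact j)"
    using False p d by (intro multiplicity_geI) auto
  also have "\<dots> = multiplicity (int p) c + alpha p j"
    using False p by (subst prime_elem_multiplicity_mult_distrib) (auto simp: multiplicity_fact_int)
  finally show ?thesis by (intro multiplicity_dvd') simp
qed simp

section \<open>Divisibility of the resultant by comparing determinants\<close>

lemma prime_power_dvd_resultant:
  fixes f g :: "int poly" and a :: int and p k :: nat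
  assumes p: "prime p" and monic: "monic f" "monic g"
    and fg: "\<And>x. int p ^ s dvd poly f x \<and> int p ^ s dvd poly g x"
    and a: "int p ^ S dvd poly f a" "int p ^ S dvd poly g a"
  defines "m \<equiv> degree f" and "n \<equiv> degree g + k"
  shows "int p ^ (\<Sum>j<m + n. if j = 0 then S + t else s + t - alpha p j)
    dvd int p ^ ((\<Sum>l<n. t - alpha p l) + (\<Sum>l<m. t - alpha p l)) * resultant f g"
proof -
  define N where "N = m + n"
  define H where "H = row_poly m n (ffact_poly a) f g"
  \<comment> \<open>\<open>l i\<close> is the degree of the falling factorial multiplier of row \<open>i\<close>, \<open>w i\<close> the exponent scaling it.\<close>
  define l where "l i = (if i < n then n - 1 - i else N - 1 - i)" for i
  define w where "w i = t - alpha p (l i)" for i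
  define e where "e j = (if j = 0 then S + t else s + t - alpha p j)" for j
  have H_eq: "H i = ffact_poly a (l i) * (if i < n then f else g)" for i
    by (simp add: H_def row_poly_def l_def N_def)
  have "coeff (H i) j = 0" if "i < N" "N \<le> j" for i j
  proof (rule coeff_eq_0)
    have "degree (H i) \<le> l i + degree (if i < n then f else g)"
      unfolding H_eq using degree_mult_le[of "ffact_poly a (l i)"] by simp
    also have "\<dots> < N"
      using that by (auto simp: l_def N_def m_def n_def)
    finally show "degree (H i) < j" using that by simp
  qed
  then have "\<forall>i. \<exists>c. i < N \<longrightarrow> H i = (\<Sum>j<N. smult (c j) (ffact_poly a j))"
    using newton_expansion_exists by blast
  then obtain C where C: "H i = (\<Sum>j<N. smult (C i j) (ffact_poly a j))" if "i < N" for i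
    by metis

  \<comment> \<open>\<open>A\<close> holds the Newton coefficients of the rows, and \<open>F\<close>
    is the unitriangular passage from the Newton basis to monomials.\<close>
  define A where "A = mat N N (\<lambda>(i, j). C i (N - 1 - j))"
  define F where "F = mat N N (\<lambda>(i, j). coeff (ffact_poly a (N - 1 - i)) (N - 1 - j))"
  have "A * F = mat N N (\<lambda>(i, j). coeff (H i) (N - 1 - j))" (is "_ = ?R")
  proof (rule eq_matI)
    fix i j assume "i < dim_row ?R" "j < dim_col ?R"
    then have i: "i < N" and j: "j < N" by auto
    have "(A * F) $$ (i, j)
        = (\<Sum>l<N. C i (N - 1 - l) * coeff (ffact_poly a (N - 1 - l)) (N - 1 - j))"
      using i j by (simp add: A_def F_def scalar_prod_def atLeast0LessThan)
    also have "\<dots> = (\<Sum>l<N. C i l * coeff (ffact_poly a l) (N - 1 - j))"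
      by (subst sum.nat_diff_reindex[symmetric]) simp
    also have "\<dots> = coeff (H i) (N - 1 - j)"
      by (simp add: C[OF i] coeff_sum)
    finally show "(A * F) $$ (i, j) = ?R $$ (i, j)" using i j by simp
  qed (auto simp: A_def F_def)
  moreover have "det (A * F) = det A * det F"
    by (rule det_mult) (auto simp: A_def F_def)
  moreover have "det F = 1"
    unfolding F_def using monic_ffact_poly[of a]
    by (intro det_unitriangular) (auto intro!: coeff_eq_0)
  moreover have "det ?R = resultant f g"
    using det_row_poly[of "ffact_poly a" f m g n] monic_ffact_poly[of a]
      resultant_sub_monic[of f g k] monic
    by (simp add: H_def N_def m_def n_def)
  ultimately have detA: "det A = resultant f g" by simp

  have dvd: "int p ^ e j dvd int p ^ w i * C i j" if i: "i < N" and j: "j < N" for i j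
  proof -
    let ?h = "smult (int p ^ w i) (H i)"
    have h: "?h = (\<Sum>j<N. smult (int p ^ w i * C i j) (ffact_poly a j))"
      unfolding C[OF i] by (simp add: smult_sum2)
    \<comment> \<open>Used twice: with \<open>M = S\<close> at the single node \<open>a\<close>, and
      with \<open>M = s\<close> at all nodes.\<close>
    have dvd_h: "int p ^ (M + t) dvd poly ?h (a + int x)"
      if "int p ^ M dvd poly f (a + int x)" "int p ^ M dvd poly g (a + int x)" for M x
    proof -
      have "int p ^ t dvd int p ^ w i * fact (l i)"
        unfolding w_def by (rule power_dvd_power_mult_fact)
      then have "int p ^ M * int p ^ t
          dvd poly (if i < n then f else g) (a + int x) * (int p ^ w i * fact (l i))"
        using that by (intro mult_dvd_mono) auto
      then have "int p ^ (M + t) dvd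
          poly (if i < n then f else g) (a + int x) * (int p ^ w i * fact (l i)) * int (x choose l i)"
        unfolding power_add by (rule dvd_mult2)
      then show ?thesis
        by (simp add: H_eq poly_ffact_poly mult_ac)
    qed
    show ?thesis
    proof (cases "j = 0")
      case True
      have "int p ^ (S + t) dvd poly ?h a"
        using dvd_h[of S 0] a by simp
      also have "poly ?h a = int p ^ w i * C i 0"
        using j by (intro newton_coeff_0[OF h, symmetric]) simp
      finally show ?thesis
        using True by (simp add: e_def)
    next
      case False
      have "int p ^ (s + t) dvd int p ^ w i * C i j * fact j"
        using fg by (intro newton_coeff_dvd[OF h] dvd_h j) auto
      then show ?thesis
        using False power_dvd_mult_fact_cancel[OF p] by (simp add: e_def)
    qed
  qed
  \<comment> \<open>Column \<open>j\<close> of \<open>A\<close> belongs to the basis polynomial of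
    degree \<open>N - 1 - j\<close>, hence the reversed index.\<close>
  have "(\<Prod>j<N. int p ^ e (N - 1 - j)) dvd det (mat N N (\<lambda>(i, j). int p ^ w i * A $$ (i, j)))"
    by (rule det_col_dvd) (auto simp: A_def intro!: dvd)
  also have "\<dots> = (\<Prod>i<N. int p ^ w i) * resultant f g"
    unfolding detA[symmetric] by (rule det_scale_rows) (simp add: A_def)
  also have "(\<Prod>i<N. int p ^ w i) = int p ^ (\<Sum>i<N. w i)"
    by (rule power_sum[symmetric])
  also have "(\<Sum>i<N. w i) = (\<Sum>i<n. w i) + (\<Sum>i<m. w (n + i))"
    unfolding N_def add.commute[of m n] by (induction m) (auto simp: add.assoc)
  also have "(\<Sum>i<n. w i) = (\<Sum>i<n. t - alpha p (n - Suc i))"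
    by (intro sum.cong) (auto simp: w_def l_def)
  also have "\<dots> = (\<Sum>i<n. t - alpha p i)"
    by (rule sum.nat_diff_reindex)
  also have "(\<Sum>i<m. w (n + i)) = (\<Sum>i<m. t - alpha p (m - Suc i))"
    by (intro sum.cong) (auto simp: w_def l_def N_def)
  also have "\<dots> = (\<Sum>i<m. t - alpha p i)"
    by (rule sum.nat_diff_reindex)
  also have "(\<Prod>j<N. int p ^ e (N - 1 - j)) = (\<Prod>j<N. int p ^ e j)"
    using prod.nat_diff_reindex[of "\<lambda>j. int p ^ e j" N] by simp
  also have "\<dots> = int p ^ (\<Sum>j<N. e j)"
    by (rule power_sum[symmetric])
  finally show ?thesis
    by (simp add: N_def e_def)
qed

section \<open>Sums of truncated differences and \<open>B\<close>\<close>

lemma alpha_mono: "i \<le> j \<Longrightarrow> alpha p i \<le> alpha p j"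
  unfolding alpha_def by (rule dvd_imp_multiplicity_le) (auto intro: fact_dvd)

text \<open>The minimum defining \<open>beta\<close> is attained because \<open>p ^ m\<close>
  divides \<open>fact (p ^ m)\<close>; monotonicity of \<open>alpha\<close> does the rest.\<close>

lemma beta_le_iff:
  assumes "prime p"
  shows "beta p m \<le> j \<longleftrightarrow> m \<le> alpha p j"
proof -
  have "p ^ m dvd (fact (p ^ m) :: nat)"
    using assms by (intro dvd_fact) (auto simp: Suc_le_eq prime_gt_0_nat)
  then have "m \<le> alpha p (p ^ m)"
    using assms unfolding alpha_def by (intro multiplicity_geI) auto
  then have "m \<le> alpha p (beta p m)"
    unfolding beta_def by (rule LeastI)
  then show ?thesis
    using alpha_mono[of "beta p m" j p] by (auto simp: beta_def intro: Least_le)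
qed

text \<open>Both sides count the pairs \<open>(j, i)\<close> with \<open>j < N\<close> and
  \<open>alpha p j < i \<le> m\<close>, the latter condition being \<open>j < beta p i\<close> for
  \<open>i\<close> in \<open>{1..m}\<close>.\<close>

lemma sum_diff_alpha:
  assumes "prime p"
  shows "(\<Sum>j<N. m - alpha p j) = (\<Sum>i = 1..m. min N (beta p i))"
proof -
  have "(\<Sum>j<N. m - alpha p j) = (\<Sum>j<N. \<Sum>i = 1..m. of_bool (j < beta p i))"
  proof (intro sum.cong refl)
    fix j
    have "{1..m} \<inter> {i. j < beta p i} = {alpha p j<..m}"
      using beta_le_iff[OF assms, of _ j] by (auto simp flip: not_le)
    then show "m - alpha p j = (\<Sum>i = 1..m. of_bool (j < beta p i))"
      by (simp add: sum_of_bool_eq)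
  qed
  also have "\<dots> = (\<Sum>i = 1..m. \<Sum>j<N. of_bool (j < beta p i))"
    by (rule sum.swap)
  also have "\<dots> = (\<Sum>i = 1..m. min N (beta p i))"
  proof (intro sum.cong refl)
    fix i
    have "{..<N} \<inter> {j. j < beta p i} = {..<min N (beta p i)}" by auto
    then show "(\<Sum>j<N. of_bool (j < beta p i)) = min N (beta p i)"
      by (simp add: sum_of_bool_eq)
  qed
  finally show ?thesis .
qed

lemma sum_diff_alpha_le: "prime p \<Longrightarrow> (\<Sum>j<N. m - alpha p j) \<le> B p m"
  by (auto simp: sum_diff_alpha B_def intro: sum_mono)

lemma sum_diff_alpha_eq:
  assumes "prime p" "beta p m \<le> N"
  shows "(\<Sum>j<N. m - alpha p j) = B p m"
  unfolding sum_diff_alpha[OF assms(1)] B_def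
proof (intro sum.cong refl min_absorb2)
  fix i assume "i \<in> {1..m}"
  then show "beta p i \<le> N"
    using assms beta_le_iff by (meson atLeastAtMost_iff order.trans)
qed

section \<open>The bound at each point and at the maximum\<close>

lemma multiplicity_gcd_bound:
  fixes f g :: "int poly" and a :: int
  assumes p: "prime p" and monic: "monic f" "monic g" and r: "resultant f g \<noteq> 0"
    and fg: "\<And>x. int p ^ s dvd poly f x \<and> int p ^ s dvd poly g x"
  shows "B p (s + t) + multiplicity (int p) (gcd (poly f a) (poly g a))
    \<le> multiplicity (int p) (resultant f g) + 2 * B p t + s"
proof -
  define S where "S = multiplicity (int p) (gcd (poly f a) (poly g a))"
  \<comment> \<open>The padding makes \<open>N\<close> exceed \<open>beta p (s + t)\<close>, so the
    sum over \<open>j < N\<close> is all of \<open>B p (s + t)\<close>; \<open>Suc\<close> ensures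
    that the index \<open>0\<close> occurs even when this \<open>beta\<close> is
    \<open>0\<close>.\<close>
  define k where "k = Suc (beta p (s + t))"
  define n where "n = degree g + k"
  define N where "N = degree f + n"
  let ?e = "\<lambda>j. if j = 0 then S + t else s + t - alpha p j"
  let ?w = "(\<Sum>l<n. t - alpha p l) + (\<Sum>l<degree f. t - alpha p l)"
  have S: "int p ^ S dvd poly f a" "int p ^ S dvd poly g a"
    using multiplicity_dvd[of "int p" "gcd (poly f a) (poly g a)"] by (auto simp: S_def)
  have pr: "prime_elem (int p)" using p by simp
  have "int p ^ (\<Sum>j<N. ?e j) dvd int p ^ ?w * resultant f g"
    unfolding N_def n_def by (rule prime_power_dvd_resultant[OF p monic fg S])
  then have "(\<Sum>j<N. ?e j) \<le> multiplicity (int p) (int p ^ ?w * resultant f g)"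
    using r p by (intro multiplicity_geI) auto
  also have "\<dots> = ?w + multiplicity (int p) (resultant f g)"
    using r p pr by (subst prime_elem_multiplicity_mult_distrib) auto
  also have "\<dots> \<le> 2 * B p t + multiplicity (int p) (resultant f g)"
    using sum_diff_alpha_le[OF p, of t n] sum_diff_alpha_le[OF p, of t "degree f"] by simp
  finally have le: "(\<Sum>j<N. ?e j) \<le> 2 * B p t + multiplicity (int p) (resultant f g)" .
  obtain N' where N': "N = Suc N'" by (simp add: N_def n_def k_def)
  have "B p (s + t) = (\<Sum>j<N. s + t - alpha p j)"
    by (rule sum_diff_alpha_eq[OF p, symmetric]) (simp add: N_def n_def k_def)
  \<comment> \<open>As \<open>alpha p 0 = 0\<close>, the two sums differ only at
    \<open>j = 0\<close>, where \<open>s + t\<close> is replaced by \<open>S + t\<close>.\<close>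
  then have "B p (s + t) + S = (\<Sum>j<N. ?e j) + s"
    unfolding N' sum.lessThan_Suc_shift by (simp add: alpha_def)
  with le show ?thesis by (simp add: S_def)
qed

theorem theorem3:
  fixes p s t :: nat and f g :: "int poly"
  assumes "prime p"
    and "lead_coeff f = 1" and "lead_coeff g = 1"
    and "resultant f g \<noteq> 0"
    and "\<And>n::int. int p ^ s dvd poly f n \<and> int p ^ s dvd poly g n"
  shows "int (multiplicity (int p) (resultant f g)) - int (max_gcd_val p f g)
           \<ge> int (B p (s + t)) - 2 * int (B p t) - int s"
proof -
  let ?V = "range (\<lambda>n. multiplicity (int p) (gcd (poly f n) (poly g n)))"
  have bound: "B p (s + t) + v \<le> multiplicity (int p) (resultant f g) + 2 * B p t + s"
    if "v \<in> ?V" for v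
    using that multiplicity_gcd_bound[OF assms] by auto
  \<comment> \<open>The pointwise bound also bounds the set of valuations, so the maximum is
    attained at some point.\<close>
  then have "?V \<subseteq> {..multiplicity (int p) (resultant f g) + 2 * B p t + s}"
    by (meson add_leE atMost_iff subsetI)
  then have "finite ?V"
    using finite_subset by blast
  then have "max_gcd_val p f g \<in> ?V"
    unfolding max_gcd_val_def by (rule Max_in) simp
  from bound[OF this] show ?thesis by linarith
qed

end
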